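(* Let $p,q\ge1$ be integers and let $A\in\mathrm{Aut}(D_{p,q})$ be an automorphism such that there does not exist any projective line contained in $\partial D_{p,q}$ on which every point is fixed by $A$. If $A$ has at least $2p+1$ fixed points on $\partial D_{p,q}$, then $A$ has a fixed point in $D_{p,q}$.
   Context: $H_{p,q}=\begin{pmatrix}I_p&0\\0&-I_q\end{pmatrix}$ and $\cdot^H$ is the Hermitian (conjugate) transpose. The generalized ball is $D_{p,q}=\{[z]\in\mathbb P^{p+q-1}: z^HH_{p,q}z>0\}$, with boundary $\partial D_{p,q}=\{[z]: z^HH_{p,q}z=0\}$. $\mathrm{Aut}(D_{p,q})$ is the group of biholomorphic automorphisms of $D_{p,q}$. It is known that every automorphism of $D_{p,q}$ is the restriction of a projective linear automorphism $[z]\mapsto[Az]$ of $\mathbb P^{p+q-1}$ with $A\in U(p,q)=\{A\in GL(p+q,\mathbb C):A^HH_{p,q}A=H_{p,q}\}$; automorphisms act on $\partial D_{p,q}$ through these projective linear maps. *)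

theory Defs
  imports "HOL-Analysis.Analysis"
begin

subsection \<open>Complex projective space\<close>

definition proportional :: "complex ^ 'n \<Rightarrow> complex ^ 'n \<Rightarrow> bool" where
  "proportional x y \<longleftrightarrow> x \<noteq> 0 \<and> y \<noteq> 0 \<and> (\<exists>c. y = c *s x)"

text \<open>
  The space of complex lines through the origin of \<open>complex ^ 'n\<close>, of dimension \<open>CARD('n) - 1\<close>.
  The point \<open>[z]\<close> is \<open>proj_pt z\<close>; it is meaningful only for \<open>z \<noteq> 0\<close>, as the quotient is partial.
\<close>
quotient_type (overloaded) 'n cproj = "complex ^ ('n :: finite)" / partial: proportional
  morphisms proj_rep proj_pt
proof (rule part_equivpI)
  show "\<exists>x :: complex ^ 'n. proportional x x"
    unfolding proportional_def
    by (rule exI[of _ "axis undefined 1"])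
      (auto simp: axis_eq_0_iff intro!: exI[of _ "1 :: complex"])
  show "symp (proportional :: complex ^ 'n \<Rightarrow> _)"
  proof (rule sympI)
    fix x y :: "complex ^ 'n" assume "proportional x y"
    then obtain c where c: "x \<noteq> 0" "y \<noteq> 0" "y = c *s x" unfolding proportional_def by blast
    then have "x = inverse c *s y" by (cases "c = 0") (auto simp: vec_eq_iff)
    then show "proportional y x" unfolding proportional_def using c(1,2) by blast
  qed
  show "transp (proportional :: complex ^ 'n \<Rightarrow> _)"
    by (rule transpI) (auto simp: proportional_def)
qed

lemma proj_pt_eq_iff:
  assumes "x \<noteq> 0" "y \<noteq> 0"
  shows "proj_pt x = proj_pt y \<longleftrightarrow> (\<exists>c. y = c *s x)"
proof -
  have "proportional x x" "proportional y y"
    using assms by (auto simp: proportional_def intro!: exI[of _ "1 :: complex"])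
  then show ?thesis
    using Quotient_rel[OF Quotient_cproj, of x y] assms by (auto simp: proportional_def)
qed

lemma proj_rep_nonzero: "proj_rep P \<noteq> 0"
  using Quotient_rep_reflp[OF Quotient_cproj, of P] by (simp add: proportional_def)

lemma proj_pt_rep [simp]: "proj_pt (proj_rep P) = P"
  by (rule Quotient_abs_rep[OF Quotient_cproj])

lemma proj_pt_cases: obtains z where "z \<noteq> 0" "P = proj_pt z"
  using proj_rep_nonzero proj_pt_rep by metis

text \<open>The quotient topology.\<close>
instantiation cproj :: (finite) topological_space
begin

definition open_cproj :: "'a cproj set \<Rightarrow> bool" where
  "open_cproj W \<longleftrightarrow> open {z. z \<noteq> 0 \<and> proj_pt z \<in> W}"

instance
proof
  have "{z :: complex ^ 'a. z \<noteq> 0} = - {0}" by auto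
  then show "open (UNIV :: 'a cproj set)"
    unfolding open_cproj_def by (simp add: open_Compl)
  show "open (S \<inter> T)" if "open S" "open T" for S T :: "'a cproj set"
  proof -
    have "{z. z \<noteq> 0 \<and> proj_pt z \<in> S \<inter> T}
        = {z. z \<noteq> 0 \<and> proj_pt z \<in> S} \<inter> {z. z \<noteq> 0 \<and> proj_pt z \<in> T}" by auto
    with that show ?thesis unfolding open_cproj_def by auto
  qed
  show "open (\<Union>K)" if "\<forall>S\<in>K. open S" for K :: "'a cproj set set"
  proof -
    have "{z. z \<noteq> 0 \<and> proj_pt z \<in> \<Union>K} = (\<Union>S\<in>K. {z. z \<noteq> 0 \<and> proj_pt z \<in> S})" by auto
    with that show ?thesis unfolding open_cproj_def by auto
  qed
qed

end

definition projective_line :: "('n :: finite) cproj set \<Rightarrow> bool" where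
  "projective_line l \<longleftrightarrow>
    (\<exists>W. vec.subspace W \<and> vec.dim W = 2 \<and> l = {proj_pt z | z. z \<in> W \<and> z \<noteq> 0})"

text \<open>Intended for invertible \<open>M\<close> only.\<close>
definition proj_map :: "complex ^ 'n ^ 'n \<Rightarrow> ('n :: finite) cproj \<Rightarrow> 'n cproj" where
  "proj_map M P = proj_pt (M *v proj_rep P)"

lemma invertible_mult_vec_nonzero:
  fixes M :: "complex ^ 'n ^ ('n :: finite)"
  assumes "invertible M" "z \<noteq> 0"
  shows "M *v z \<noteq> 0"
proof -
  obtain N where "N ** M = mat 1" using assms(1) unfolding invertible_def by blast
  then have "N *v (M *v z) = z" by (simp add: matrix_vector_mul_assoc)
  then show ?thesis using assms(2) by auto
qed

lemma proj_map_pt: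
  assumes "invertible M" "z \<noteq> 0"
  shows "proj_map M (proj_pt z) = proj_pt (M *v z)"
proof -
  let ?r = "proj_rep (proj_pt z)"
  have "?r \<noteq> 0" by (rule proj_rep_nonzero)
  moreover obtain c where "z = c *s ?r"
    using proj_pt_eq_iff[of ?r z] assms(2) proj_rep_nonzero by auto
  then have "M *v z = c *s (M *v ?r)" by (metis vector_scalar_commute)
  ultimately show ?thesis
    unfolding proj_map_def using assms invertible_mult_vec_nonzero proj_pt_eq_iff by metis
qed


subsection \<open>Holomorphic maps between subsets of projective space\<close>

definition affine_patch :: "'n \<Rightarrow> ('n :: finite) cproj set" where
  "affine_patch i = {proj_pt z | z. z $ i \<noteq> 0}"

text \<open>
  The chart of \<open>affine_patch i\<close>, whose target is the affine hyperplane \<open>{w. w $ i = 1}\<close> instead of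
  the space of the remaining coordinates; its inverse is \<open>proj_pt\<close>.
\<close>
lift_definition affine_chart :: "'n \<Rightarrow> ('n :: finite) cproj \<Rightarrow> complex ^ 'n"
  is "\<lambda>i z. inverse (z $ i) *s z"
  by (auto simp: proportional_def vec_eq_iff)

text \<open>Differentiability with a complex linear derivative.\<close>
definition complex_differentiable_within ::
    "(complex ^ 'm \<Rightarrow> complex ^ 'n) \<Rightarrow> complex ^ 'm \<Rightarrow> (complex ^ 'm) set \<Rightarrow> bool" where
  "complex_differentiable_within F w S \<longleftrightarrow>
    (\<exists>F'. (F has_derivative F') (at w within S) \<and> (\<forall>c v. F' (c *s v) = c *s F' v))"

text \<open>
  Continuity together with holomorphy in affine charts of source and target. When \<open>X\<close> is open, the
  set in the last line is a relatively open subset of the hyperplane \<open>{w. w $ i = 1}\<close>, so that this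
  is differentiability of the chart expression as a function of the remaining coordinates.
\<close>
definition proj_holomorphic_on ::
    "(('m :: finite) cproj \<Rightarrow> ('n :: finite) cproj) \<Rightarrow> 'm cproj set \<Rightarrow> bool" where
  "proj_holomorphic_on f X \<longleftrightarrow> continuous_on X f \<and>
    (\<forall>i j. \<forall>P \<in> X \<inter> affine_patch i. f P \<in> affine_patch j \<longrightarrow>
      complex_differentiable_within (\<lambda>w. affine_chart j (f (proj_pt w))) (affine_chart i P)
        {w. w $ i = 1 \<and> proj_pt w \<in> X \<and> f (proj_pt w) \<in> affine_patch j})"

text \<open>Only the restriction of \<open>f\<close> to \<open>X\<close> is relevant.\<close>
definition biholomorphic_automorphism ::
    "('n :: finite) cproj set \<Rightarrow> ('n cproj \<Rightarrow> 'n cproj) \<Rightarrow> bool" where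
  "biholomorphic_automorphism X f \<longleftrightarrow>
    bij_betw f X X \<and> proj_holomorphic_on f X \<and> proj_holomorphic_on (inv_into X f) X"


subsection \<open>Generalized balls\<close>

text \<open>
  The index type \<open>'p + 'q\<close> splits the coordinates into the first \<open>p = CARD('p)\<close> and the last
  \<open>q = CARD('q)\<close>; both numbers are arbitrary and at least 1.
\<close>
definition H_mat :: "complex ^ ('p + 'q) ^ ('p :: finite + 'q :: finite)" where
  "H_mat = (\<chi> i j. if i = j then (case i of Inl _ \<Rightarrow> 1 | Inr _ \<Rightarrow> - 1) else 0)"

definition hermitian_transpose :: "complex ^ 'n ^ 'm \<Rightarrow> complex ^ 'm ^ 'n" where
  "hermitian_transpose M = (\<chi> i j. cnj (M $ j $ i))"

definition herm_form :: "complex ^ ('p :: finite + 'q :: finite) \<Rightarrow> complex" where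
  "herm_form z = (\<Sum>i\<in>UNIV. cnj (z $ i) * (H_mat *v z) $ i)"

lemma herm_form_real: "herm_form z \<in> \<real>"
proof -
  have "(H_mat *v z) $ i = (case i of Inl _ \<Rightarrow> z $ i | Inr _ \<Rightarrow> - z $ i)" for i
    by (simp add: H_mat_def matrix_vector_mult_def if_distrib[of "\<lambda>x. x * _"] cong: if_cong
        split: sum.split)
  moreover have "cnj a * a \<in> \<real>" for a
    by (simp add: complex_is_Real_iff)
  ultimately show ?thesis
    unfolding herm_form_def by (auto intro!: sum_in_Reals split: sum.split)
qed

definition gen_ball :: "('p :: finite + 'q :: finite) cproj set" where
  "gen_ball = {proj_pt z | z. z \<noteq> 0 \<and> Re (herm_form z) > 0}"

definition gen_ball_boundary :: "('p :: finite + 'q :: finite) cproj set" where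
  "gen_ball_boundary = {proj_pt z | z. z \<noteq> 0 \<and> herm_form z = 0}"

definition U_group :: "(complex ^ ('p + 'q) ^ ('p :: finite + 'q :: finite)) set" where
  "U_group = {A. invertible A \<and> hermitian_transpose A ** H_mat ** A = H_mat}"

text \<open>
  An automorphism acts on the boundary through the projective linear map, given by an element of
  \<open>U(p,q)\<close>, that it is a restriction of. Such a map exists for every automorphism, and it is unique
  since \<open>gen_ball\<close> is open and nonempty.
\<close>
definition boundary_fixed_points ::
    "(('p :: finite + 'q :: finite) cproj \<Rightarrow> ('p + 'q) cproj) \<Rightarrow> ('p + 'q) cproj set" where
  "boundary_fixed_points f =
    {P \<in> gen_ball_boundary.
      \<exists>A \<in> U_group. (\<forall>Q \<in> gen_ball. f Q = proj_map A Q) \<and> proj_map A P = P}"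

end

theory Submission
  imports Defs
begin

text \<open>
  Suppose that no eigenvector of \<open>A \<in> U(p,q)\<close> is positive. Then the form is negative semidefinite on
  every eigenspace, so the null vectors in an eigenspace form an isotropic subspace, which has
  dimension at most 1 by the assumption on lines. Hence the fixed points on the boundary
  belong to distinct eigenvalues. Eigenvectors for \<open>\<lambda>\<close> and \<open>\<mu>\<close> are orthogonal unless
  \<open>cnj \<lambda> * \<mu> = 1\<close>. Among \<open>2 * p + 1\<close> eigenvalues, at least \<open>p + 1\<close> lie on one side of the unit circle
  (the circle included); their null eigenvectors are pairwise orthogonal and span
  an isotropic subspace of dimension \<open>p + 1\<close>, but isotropic subspaces have dimension at most \<open>p\<close>.
\<close>

subsection \<open>The sesquilinear form\<close>

definition herm_prod :: "complex ^ ('p :: finite + 'q :: finite) \<Rightarrow> complex ^ ('p + 'q) \<Rightarrow> complex" where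
  "herm_prod x y = (\<Sum>i\<in>UNIV. cnj (x $ i) * (H_mat *v y) $ i)"

lemma herm_form_eq_herm_prod: "herm_form z = herm_prod z z"
  by (simp add: herm_form_def herm_prod_def)

lemma H_mat_mult_vec_nth:
  "(H_mat *v z) $ i = (case i of Inl _ \<Rightarrow> z $ i | Inr _ \<Rightarrow> - z $ i)"
  by (simp add: H_mat_def matrix_vector_mult_def if_distrib[of "\<lambda>x. x * _"] cong: if_cong
      split: sum.split)

lemma herm_prod_add_left: "herm_prod (x + y) z = herm_prod x z + herm_prod y z"
  by (simp add: herm_prod_def sum.distrib algebra_simps)

lemma herm_prod_add_right: "herm_prod x (y + z) = herm_prod x y + herm_prod x z"
  by (simp add: herm_prod_def sum.distrib algebra_simps)

lemma herm_prod_scale_left: "herm_prod (c *s x) y = cnj c * herm_prod x y"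
  by (simp add: herm_prod_def sum_distrib_left algebra_simps)

lemma herm_prod_scale_right: "herm_prod x (c *s y) = c * herm_prod x y"
  by (simp add: herm_prod_def vector_scalar_commute sum_distrib_left
      algebra_simps)

lemma herm_prod_zero_left [simp]: "herm_prod 0 y = 0"
  by (simp add: herm_prod_def)

lemma herm_prod_zero_right [simp]: "herm_prod x 0 = 0"
  by (simp add: herm_prod_def)

lemma herm_prod_commute: "herm_prod y x = cnj (herm_prod x y)"
  by (auto simp: herm_prod_def H_mat_mult_vec_nth algebra_simps intro!: sum.cong split: sum.split)

lemma herm_form_scale: "herm_form (c *s z) = cnj c * c * herm_form z"
  by (simp add: herm_form_eq_herm_prod herm_prod_scale_left herm_prod_scale_right)

text \<open>Serves to show that the set of positive vectors is open.\<close>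

lemma continuous_on_herm_form:
  "continuous_on UNIV (herm_form :: complex ^ ('p :: finite + 'q :: finite) \<Rightarrow> complex)"
  unfolding herm_form_def H_mat_mult_vec_nth
proof (intro continuous_intros)
  show "continuous_on UNIV (\<lambda>z :: complex ^ ('p + 'q).
      case i of Inl _ \<Rightarrow> z $ i | Inr _ \<Rightarrow> - z $ i)" for i
    by (cases i) (auto intro!: continuous_intros)
qed

text \<open>Adjointness for the standard Hermitian product; it brings the relation defining
  \<open>U_group\<close> to bear on \<open>herm_prod\<close>.\<close>

lemma sum_cnj_matrix_mult_vec:
  fixes M :: "complex ^ 'm :: finite ^ 'n :: finite"
  shows "(\<Sum>i\<in>UNIV. cnj ((M *v x) $ i) * w $ i) = (\<Sum>j\<in>UNIV. cnj (x $ j) * (hermitian_transpose M *v w) $ j)"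
  by (simp add: matrix_vector_mult_def hermitian_transpose_def sum_distrib_left sum_distrib_right
      algebra_simps) (rule sum.swap)

lemma U_group_herm_prod:
  assumes "A \<in> U_group"
  shows "herm_prod (A *v x) (A *v y) = herm_prod x y"
proof -
  have "hermitian_transpose A *v (H_mat *v (A *v y)) = H_mat *v y"
    using assms by (simp add: U_group_def matrix_vector_mul_assoc matrix_mul_assoc)
  then show ?thesis
    by (simp add: herm_prod_def sum_cnj_matrix_mult_vec)
qed

text \<open>Invariance of the form under \<open>A\<close> gives
  \<open>cnj a * b * herm_prod x y = herm_prod x y\<close>.\<close>

lemma U_group_eigenvectors_orthogonal:
  assumes "A \<in> U_group" "A *v x = a *s x" "A *v y = b *s y" "cnj a * b \<noteq> 1"
  shows "herm_prod x y = 0"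
  using U_group_herm_prod[OF assms(1), of x y] assms
  by (simp add: herm_prod_scale_left herm_prod_scale_right mult.commute)

subsection \<open>Isotropic subspaces\<close>

text \<open>On vectors whose first block vanishes, the form is minus the sum of the squared moduli,
  hence negative definite.\<close>

lemma herm_form_zero_imp_zero:
  fixes z :: "complex ^ ('p :: finite + 'q :: finite)"
  assumes "herm_form z = 0" "\<And>i. z $ Inl i = 0"
  shows "z = 0"
proof -
  have "0 = (\<Sum>i\<in>UNIV. - ((cmod (z $ i))\<^sup>2))"
  proof -
    have "cnj (z $ i) * (H_mat *v z) $ i = of_real (- ((cmod (z $ i))\<^sup>2))" for i
      using assms(2) complex_norm_square[of "z $ i"]
      by (auto simp: H_mat_mult_vec_nth mult.commute split: sum.split)
    then have "herm_form z = of_real (\<Sum>i\<in>UNIV. - ((cmod (z $ i))\<^sup>2))"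
      by (simp add: herm_form_def)
    then show ?thesis using assms(1) by (metis of_real_eq_0_iff)
  qed
  then have "\<forall>i. cmod (z $ i) = 0"
    by (simp add: sum_negf sum_nonneg_eq_0_iff)
  then show ?thesis by (simp add: vec_eq_iff)
qed

lemma isotropic_span:
  assumes "\<And>x y. x \<in> B \<Longrightarrow> y \<in> B \<Longrightarrow> herm_prod x y = 0" "u \<in> vec.span B" "v \<in> vec.span B"
  shows "herm_prod u v = 0"
  using assms(2)
proof (induction rule: vec.span_induct_alt)
  case base
  show ?case by simp
next
  case (step c x y)
  have "herm_prod x v = 0"
    using assms(3)
  proof (induction rule: vec.span_induct_alt)
    case base
    show ?case by simp
  next
    case (step d a b)
    then show ?case
      using assms(1) \<open>x \<in> B\<close> by (simp add: herm_prod_add_right herm_prod_scale_right)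
  qed
  with step show ?case by (simp add: herm_prod_add_left herm_prod_scale_left)
qed

text \<open>Projection to the first block is injective on the span of \<open>B\<close>: a difference
  in its kernel is a null vector with zero first block, hence 0. So \<open>B\<close> has an
  independent image of the same size in a space of dimension \<open>CARD('p)\<close>.\<close>

lemma isotropic_independent_card_le:
  fixes B :: "(complex ^ ('p :: finite + 'q :: finite)) set"
  assumes "vec.independent B" "\<And>x y. x \<in> B \<Longrightarrow> y \<in> B \<Longrightarrow> herm_prod x y = 0"
  shows "card B \<le> CARD('p)"
proof -
  define \<pi> :: "complex ^ ('p + 'q) \<Rightarrow> complex ^ 'p" where "\<pi> z = (\<chi> i. z $ Inl i)" for z
  have lin: "Vector_Spaces.linear (*s) (*s) \<pi>"
    by unfold_locales (auto simp: \<pi>_def vec_eq_iff algebra_simps)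
  have inj: "inj_on \<pi> (vec.span B)"
  proof (rule inj_onI)
    fix x y assume xy: "x \<in> vec.span B" "y \<in> vec.span B" "\<pi> x = \<pi> y"
    then have "x - y \<in> vec.span B" by (rule_tac vec.span_diff)
    then have "herm_form (x - y) = 0"
      by (simp add: herm_form_eq_herm_prod isotropic_span[OF assms(2)])
    moreover have "(x - y) $ Inl i = 0" for i
      using xy(3) by (simp add: \<pi>_def vec_eq_iff)
    ultimately have "x - y = 0" by (rule herm_form_zero_imp_zero)
    then show "x = y" by simp
  qed
  have "vec.independent (\<pi> ` B)"
    using vec.linear_independent_injective_image[OF lin assms(1) inj] .
  then have "card (\<pi> ` B) \<le> vec.dim (UNIV :: (complex ^ 'p) set)"
    by (intro vec.independent_card_le_dim) auto
  moreover have "card (\<pi> ` B) = card B"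
    using inj_on_subset[OF inj vec.span_superset] by (rule card_image)
  ultimately show ?thesis by (simp add: vec.dim_UNIV card_cart_basis)
qed

section \<open>Null eigenvectors for distinct eigenvalues\<close>

lemma eigenvectors_independent:
  fixes A :: "complex ^ 'n :: finite ^ 'n"
  assumes "finite I" "inj_on e I"
    and "\<And>i. i \<in> I \<Longrightarrow> v i \<noteq> 0" "\<And>i. i \<in> I \<Longrightarrow> A *v v i = e i *s v i"
    and "(\<Sum>i\<in>I. c i *s v i) = 0" "i \<in> I"
  shows "c i = 0"
  using assms
proof (induction I arbitrary: c i rule: finite_induct)
  case empty
  then show ?case by simp
next
  case (insert k I)
  note zero = \<open>(\<Sum>i\<in>insert k I. c i *s v i) = 0\<close>
  \<comment> \<open>Apply \<open>A\<close> minus \<open>e k\<close> to the relation: the term of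
    \<open>k\<close> drops out and every other term gains the factor \<open>e i - e k\<close>, which
    is nonzero because \<open>e\<close> is injective.\<close>
  have "0 = A *v (\<Sum>i\<in>insert k I. c i *s v i) - e k *s (\<Sum>i\<in>insert k I. c i *s v i)"
    by (simp only: zero) simp
  also have "\<dots> = (\<Sum>i\<in>insert k I. (c i * (e i - e k)) *s v i)"
    by (simp only: vec.linear_sum[OF matrix_vector_mul_linear_gen] vec.scale_sum_right
        flip: sum_subtractf)
      (rule sum.cong, simp_all add: insert.prems(3) algebra_simps vector_scalar_commute)
  also have "\<dots> = (\<Sum>i\<in>I. (c i * (e i - e k)) *s v i)"
    using insert.hyps by simp
  finally have "(\<Sum>i\<in>I. (c i * (e i - e k)) *s v i) = 0" by simp
  moreover have "inj_on e I" using insert.prems(1) by (simp add: inj_on_insert)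
  ultimately have "c j * (e j - e k) = 0" if "j \<in> I" for j
    using insert.IH[of "\<lambda>i. c i * (e i - e k)" j] insert.prems that by auto
  moreover have "e j \<noteq> e k" if "j \<in> I" for j
    using insert.prems(1) insert.hyps that by (auto simp: inj_on_def)
  ultimately have I: "c j = 0" if "j \<in> I" for j
    using that by auto
  then have "c k *s v k = 0"
    using zero insert.hyps by (simp add: sum.neutral)
  then have "c k = 0" using insert.prems(2) by (simp add: vec_eq_iff) blast
  with I insert.prems(5) show ?case by auto
qed

text \<open>Distinct eigenvalues make the vectors independent. They are mutually orthogonal by
  \<open>ne\<close> and orthogonal to themselves by nullity, so the bound for isotropic sets
  applies.\<close>

lemma U_group_null_eigenvectors_card_le:
  fixes A :: "complex ^ ('p + 'q) ^ ('p :: finite + 'q :: finite)"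
  assumes A: "A \<in> U_group" and fin: "finite I" and e: "inj_on e I"
    and v: "\<And>i. i \<in> I \<Longrightarrow> v i \<noteq> 0" "\<And>i. i \<in> I \<Longrightarrow> A *v v i = e i *s v i"
      "\<And>i. i \<in> I \<Longrightarrow> herm_form (v i) = 0"
    and ne: "\<And>i j. i \<in> I \<Longrightarrow> j \<in> I \<Longrightarrow> i \<noteq> j \<Longrightarrow> cnj (e i) * e j \<noteq> 1"
  shows "card I \<le> CARD('p)"
proof -
  have inj: "inj_on v I"
  proof (rule inj_onI)
    fix i j assume ij: "i \<in> I" "j \<in> I" "v i = v j"
    then have "e i *s v i = e j *s v i" using v(2) by metis
    then have "e i = e j" using v(1)[OF ij(1)] by simp
    then show "i = j" using e ij by (auto simp: inj_on_def)
  qed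
  have "vec.independent (v ` I)"
    unfolding vec.independent_explicit_finite_subsets
  proof (intro allI impI ballI)
    fix S c x assume S: "S \<subseteq> v ` I" "finite S" "(\<Sum>x\<in>S. c x *s x) = 0" "x \<in> S"
    then obtain J where J: "J \<subseteq> I" "S = v ` J" by (metis subset_imageE)
    then have injJ: "inj_on v J" using inj inj_on_subset by blast
    obtain j where j: "j \<in> J" "x = v j" using S J by auto
    have "(\<Sum>j\<in>J. c (v j) *s v j) = 0"
      using S(3) unfolding J(2) by (simp add: sum.reindex[OF injJ])
    then show "c x = 0"
      using eigenvectors_independent[of J e v A "\<lambda>j. c (v j)" j] J j v
        finite_subset[OF J(1) fin] inj_on_subset[OF e J(1)] by blast
  qed
  moreover have "herm_prod x y = 0" if xy: "x \<in> v ` I" "y \<in> v ` I" for x y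
  proof -
    obtain i j where "i \<in> I" "j \<in> I" "x = v i" "y = v j" using xy by blast
    then show ?thesis
      using v(3)[of i] U_group_eigenvectors_orthogonal[OF A v(2)[of i] v(2)[of j] ne[of i j]]
      by (cases "i = j") (auto simp: herm_form_eq_herm_prod)
  qed
  ultimately have "card (v ` I) \<le> CARD('p)" by (rule isotropic_independent_card_le)
  then show ?thesis using inj by (simp add: card_image)
qed

text \<open>The moduli have product 1 and lie on the same side of 1, so both equal 1. Then
  \<open>cnj a\<close> is the inverse of \<open>a\<close>, which forces
  \<open>b = a\<close>.\<close>

lemma cnj_mult_eq_1_imp_eq:
  assumes "cnj a * b = 1" "cmod a \<le> 1 \<and> cmod b \<le> 1 \<or> 1 \<le> cmod a \<and> 1 \<le> cmod b"
  shows "a = b"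
proof -
  have ab: "cmod a * cmod b = 1"
    using assms(1) by (metis complex_mod_cnj norm_mult norm_one)
  have "cmod a = 1"
  proof -
    consider "cmod a \<le> 1" "cmod b \<le> 1" | "1 \<le> cmod a" "1 \<le> cmod b" using assms(2) by blast
    then show ?thesis
    proof cases
      case 1
      then have "cmod a * cmod b \<le> cmod a" by (simp add: mult_left_le)
      with ab 1 show ?thesis by simp
    next
      case 2
      then have "cmod a * 1 \<le> cmod a * cmod b" by (intro mult_left_mono) auto
      with ab 2 show ?thesis by simp
    qed
  qed
  then have "a * cnj a = 1" using complex_norm_square[of a] by simp
  with assms(1) show ?thesis by (metis mult.assoc mult.commute mult_1)
qed

lemma U_group_null_eigenvalues_card_le:
  fixes A :: "complex ^ ('p + 'q) ^ ('p :: finite + 'q :: finite)"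
  assumes A: "A \<in> U_group" and fin: "finite I" and e: "inj_on e I"
    and v: "\<And>i. i \<in> I \<Longrightarrow> v i \<noteq> 0" "\<And>i. i \<in> I \<Longrightarrow> A *v v i = e i *s v i"
      "\<And>i. i \<in> I \<Longrightarrow> herm_form (v i) = 0"
  shows "card I \<le> 2 * CARD('p)"
proof -
  have "card J \<le> CARD('p)"
    if J: "J = {i \<in> I. cmod (e i) \<le> 1} \<or> J = {i \<in> I. 1 \<le> cmod (e i)}" for J
  proof (rule U_group_null_eigenvectors_card_le[OF A, where v = v])
    show "finite J" using J fin by auto
    show "inj_on e J" using J e by (auto simp: inj_on_def)
    show "cnj (e i) * e j \<noteq> 1" if "i \<in> J" "j \<in> J" "i \<noteq> j" for i j
      using that J e cnj_mult_eq_1_imp_eq[of "e i" "e j"] by (auto simp: inj_on_def)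
  qed (use J v in auto)
  \<comment> \<open>The closed sides overlap in the unit circle, but together they cover
    \<open>I\<close>, which suffices for an upper bound.\<close>
  from this[of "{i \<in> I. cmod (e i) \<le> 1}"] this[of "{i \<in> I. 1 \<le> cmod (e i)}"]
  have "card {i \<in> I. cmod (e i) \<le> 1} + card {i \<in> I. 1 \<le> cmod (e i)} \<le> 2 * CARD('p)" by simp
  moreover have "I = {i \<in> I. cmod (e i) \<le> 1} \<union> {i \<in> I. 1 \<le> cmod (e i)}" by auto
  then have "card I \<le> card {i \<in> I. cmod (e i) \<le> 1} + card {i \<in> I. 1 \<le> cmod (e i)}"
    using card_Un_le by metis
  ultimately show ?thesis by simp
qed

subsection \<open>Eigenspaces without positive vectors\<close>

lemma null_vectors_orthogonal:
  assumes "herm_form u = 0" "herm_form v = 0"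
    and "\<And>a. Re (herm_form (a *s u + v)) \<le> 0"
  shows "herm_prod u v = 0"
proof -
  \<comment> \<open>Taking \<open>a = s\<close> turns both cross terms into the squared modulus of
    \<open>s\<close>, so the form at \<open>s *s u + v\<close> could only be nonpositive if
    \<open>s\<close> vanishes.\<close>
  define s where "s = herm_prod u v"
  have "herm_form (s *s u + v) = 2 * (cnj s * s)"
    using assms(1,2) herm_prod_commute[of v u] unfolding s_def
    by (simp add: herm_form_eq_herm_prod herm_prod_add_left herm_prod_add_right
        herm_prod_scale_left herm_prod_scale_right)
  also have "\<dots> = of_real (2 * (cmod s)\<^sup>2)"
    using complex_norm_square[of s] by (simp add: mult.commute)
  finally have "(cmod s)\<^sup>2 \<le> 0" using assms(3)[of s] by simp
  then show ?thesis unfolding s_def by simp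
qed

text \<open>Take the span of \<open>u\<close> and \<open>v\<close>. All its vectors are eigenvectors
  for \<open>e\<close>, none of them positive, which makes the null vectors \<open>u\<close> and
  \<open>v\<close> orthogonal and their span isotropic.\<close>

lemma null_eigenvectors_isotropic_line:
  fixes u v :: "complex ^ ('p :: finite + 'q :: finite)"
  assumes "herm_form u = 0" "herm_form v = 0" "A *v u = e *s u" "A *v v = e *s v"
    and "u \<noteq> 0" "\<nexists>c. v = c *s u"
    and "\<And>z. A *v z = e *s z \<Longrightarrow> Re (herm_form z) \<le> 0"
  obtains W where "vec.subspace W" "vec.dim W = 2"
    "\<And>z. z \<in> W \<Longrightarrow> A *v z = e *s z" "\<And>z. z \<in> W \<Longrightarrow> herm_form z = 0"
proof
  let ?W = "vec.span {u, v}"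
  show "vec.subspace ?W" by simp
  have "v \<notin> vec.span {u}" using assms(6) by (auto simp: vec.span_singleton)
  then have "vec.independent {v, u}"
    using assms(5) by (simp add: vec.independent_insert)
  then have "vec.independent {u, v}" by (simp add: insert_commute)
  then have "vec.dim ?W = card {u, v}" by (rule vec.dim_span_eq_card_independent)
  moreover have "u \<noteq> v" using assms(6) by (metis vector_smult_lid)
  ultimately show "vec.dim ?W = 2" by simp
  have eig: "A *v (a *s u + v) = e *s (a *s u + v)" for a
    using assms(3,4)
    by (simp add: matrix_vector_right_distrib vector_scalar_commute algebra_simps)
  then have "herm_prod u v = 0"
    using assms by (intro null_vectors_orthogonal) auto
  then have "herm_prod x y = 0" if "x \<in> {u, v}" "y \<in> {u, v}" for x y
    using that assms(1,2) herm_prod_commute[of v u] by (auto simp: herm_form_eq_herm_prod)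
  then show "herm_form z = 0" if "z \<in> ?W" for z
    using isotropic_span[of "{u, v}"] that by (simp add: herm_form_eq_herm_prod)
  show "A *v z = e *s z" if "z \<in> ?W" for z
    using that
  proof (induction rule: vec.span_induct_alt)
    case base
    show ?case by simp
  next
    case (step c x y)
    then have "A *v x = e *s x" using assms(3,4) by auto
    with step show ?case
      by (simp add: matrix_vector_right_distrib vector_scalar_commute algebra_simps)
  qed
qed

subsection \<open>Uniqueness of the linear map\<close>

lemma exists_positive_vector: "\<exists>z :: complex ^ ('p :: finite + 'q :: finite). Re (herm_form z) > 0"
proof -
  let ?z = "axis (Inl undefined) 1 :: complex ^ ('p + 'q)"
  have "herm_form ?z = (\<Sum>i\<in>(UNIV :: ('p + 'q) set). if i = Inl undefined then 1 else 0)"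
    unfolding herm_form_def H_mat_mult_vec_nth
    by (rule sum.cong[OF refl]) (auto simp: axis_def split: sum.split)
  also have "\<dots> = 1" by (subst sum.delta) auto
  finally show ?thesis by (intro exI[of _ ?z]) simp
qed

text \<open>The factor may a priori vary with \<open>z\<close>. Fixing one positive
  \<open>z\<close>, openness of the positive set allows small perturbations of \<open>z\<close> in
  any direction \<open>x\<close>, and these force a common factor.\<close>

lemma proportional_on_positive_imp_scalar_multiple:
  fixes A B :: "complex ^ ('p + 'q) ^ ('p :: finite + 'q :: finite)"
  assumes A: "invertible A" and proportional: "\<And>z. Re (herm_form z) > 0 \<Longrightarrow> \<exists>c. B *v z = c *s (A *v z)"
  obtains c where "\<And>x. B *v x = c *s (A *v x)"
proof -
  obtain z :: "complex ^ ('p + 'q)" where z: "Re (herm_form z) > 0"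
    using exists_positive_vector by blast
  then obtain c where c: "B *v z = c *s (A *v z)" using proportional by blast
  have "B *v x = c *s (A *v x)" for x
  \<comment> \<open>Multiples of \<open>z\<close> follow by linearity; the comparison of factors in
    the other case needs \<open>x\<close> and \<open>z\<close> independent.\<close>
  proof (cases "\<exists>a. x = a *s z")
    case True
    then obtain a where a: "x = a *s z" by blast
    have "B *v x = a *s (B *v z)" unfolding a by (simp add: vector_scalar_commute)
    also have "\<dots> = c *s (a *s (A *v z))" using c by (simp add: mult.commute)
    also have "\<dots> = c *s (A *v x)" unfolding a by (simp add: vector_scalar_commute)
    finally show ?thesis .
  next
    case False
    have "open {w :: complex ^ ('p + 'q). Re (herm_form w) > 0}"
      by (intro open_Collect_less continuous_on_Re continuous_on_herm_form continuous_on_const)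
    then obtain d where d: "d > 0" "\<And>w. dist w z < d \<Longrightarrow> Re (herm_form w) > 0"
      using z unfolding open_dist by (metis mem_Collect_eq)
    \<comment> \<open>Small enough to stay within distance \<open>d\<close> of \<open>z\<close>; the
      summand 1 keeps the denominator positive.\<close>
    define t where "t = d / (2 * (norm x + 1))"
    have t: "t > 0" "t * norm x < d"
      using d(1) by (auto simp: t_def field_simps add_pos_nonneg add_strict_increasing)
    \<comment> \<open>The factors at the two positive vectors \<open>z + t x\<close> and \<open>z + (t/2) x\<close> must both be \<open>c\<close>:
      eliminating \<open>B x\<close> gives a linear relation between \<open>z\<close> and \<open>x\<close>.\<close>
    have scale: "\<exists>k. B *v (z + of_real s *s x) = k *s (A *v (z + of_real s *s x))"
      if "0 < s" "s \<le> t" for s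
    proof (rule proportional, rule d(2))
      have "complex_of_real s *s x = s *\<^sub>R x"
        unfolding vec_eq_iff vector_scaleR_component by (simp add: scaleR_conv_of_real)
      then have "dist (z + of_real s *s x) z = s * norm x"
        using that by (simp add: dist_norm)
      also have "\<dots> \<le> t * norm x" using that by (intro mult_right_mono) auto
      finally show "dist (z + of_real s *s x) z < d" using t by simp
    qed
    obtain k1 where k1: "B *v (z + of_real t *s x) = k1 *s (A *v (z + of_real t *s x))"
      using scale[of t] t by auto
    obtain k2 where k2: "B *v (z + of_real (t/2) *s x) = k2 *s (A *v (z + of_real (t/2) *s x))"
      using scale[of "t/2"] t by auto
    have e1: "c *s (A *v z) + of_real t *s (B *v x) = k1 *s (A *v z) + (k1 * of_real t) *s (A *v x)"
      using k1 c by (simp add: matrix_vector_right_distrib vector_scalar_commute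
          vec.scale_right_distrib)
    have e2: "c *s (A *v z) + of_real (t/2) *s (B *v x) = k2 *s (A *v z) + (k2 * of_real (t/2)) *s (A *v x)"
      using k2 c by (simp add: matrix_vector_right_distrib vector_scalar_commute
          vec.scale_right_distrib)
    define T where "T = complex_of_real t"
    have T: "T \<noteq> 0" using t by (simp add: T_def)
    \<comment> \<open>This is \<open>e1\<close> minus twice \<open>e2\<close>, in which
      \<open>B *v x\<close> cancels.\<close>
    have eq0: "(k1 + c - 2 * k2) *s (A *v z) + (T * (k1 - k2)) *s (A *v x) = 0"
    proof (rule vec_eq_iff[THEN iffD2], rule allI)
      fix i
      have "c * (A *v z) $ i + T * (B *v x) $ i = k1 * (A *v z) $ i + k1 * T * (A *v x) $ i"
        using arg_cong[OF e1, of "\<lambda>w. w $ i"] by (simp add: T_def)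
      moreover have "c * (A *v z) $ i + T / 2 * (B *v x) $ i = k2 * (A *v z) $ i + k2 * (T / 2) * (A *v x) $ i"
        using arg_cong[OF e2, of "\<lambda>w. w $ i"] by (simp add: T_def)
      ultimately have "(k1 + c - 2 * k2) * (A *v z) $ i + (T * (k1 - k2)) * (A *v x) $ i = 0"
        by algebra
      then show "((k1 + c - 2 * k2) *s (A *v z) + (T * (k1 - k2)) *s (A *v x)) $ i = 0 $ i"
        by (simp only: vector_add_component vector_smult_component zero_index)
    qed
    have "A *v ((k1 + c - 2 * k2) *s z + (T * (k1 - k2)) *s x) = 0"
      using eq0 by (simp only: matrix_vector_right_distrib vector_scalar_commute)
    then have dependence: "(k1 + c - 2 * k2) *s z + (T * (k1 - k2)) *s x = 0"
      using invertible_mult_vec_nonzero[OF A] by blast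
    \<comment> \<open>A nonzero coefficient would make \<open>x\<close> a multiple of
      \<open>z\<close>.\<close>
    have "T * (k1 - k2) = 0"
    proof (rule ccontr)
      assume n: "T * (k1 - k2) \<noteq> 0"
      have "(T * (k1 - k2)) *s x = (- (k1 + c - 2 * k2)) *s z"
        using dependence by (metis add_eq_0_iff vec.scale_minus_left)
      then have "x = (inverse (T * (k1 - k2)) * (- (k1 + c - 2 * k2))) *s z"
        using n by (metis left_inverse vector_smult_assoc vector_smult_lid)
      with False show False by blast
    qed
    then have k: "k1 = k2" using T by simp
    have "z \<noteq> 0" using False z by (auto simp: herm_form_def)
    with dependence k have "c = k1" by (auto simp: vec_eq_iff)
    with e1 T show ?thesis by (simp add: T_def vec_eq_iff)
  qed
  then show thesis using that by blast
qed

section \<open>Projective maps induced by matrices\<close>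

lemma proj_map_eq_iff:
  assumes "invertible A" "invertible B" "z \<noteq> 0"
  shows "proj_map A (proj_pt z) = proj_map B (proj_pt z) \<longleftrightarrow> (\<exists>c. B *v z = c *s (A *v z))"
  using assms by (simp add: proj_map_pt proj_pt_eq_iff invertible_mult_vec_nonzero)

lemma proj_map_fixed_iff:
  assumes "invertible A" "z \<noteq> 0"
  shows "proj_map A (proj_pt z) = proj_pt z \<longleftrightarrow> (\<exists>c. A *v z = c *s z)"
  using assms proj_pt_eq_iff[of z "A *v z"]
  by (auto simp add: proj_map_pt invertible_mult_vec_nonzero eq_commute[of "proj_pt z"])

text \<open>Equality on the ball means proportional values at each positive vector, hence one scalar
  for all vectors. This makes the extension of an automorphism to the boundary well defined.\<close>

lemma proj_map_eq_if_eq_on_gen_ball: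
  fixes A B :: "complex ^ ('p + 'q) ^ ('p :: finite + 'q :: finite)"
  assumes "invertible A" "invertible B" "\<forall>Q \<in> gen_ball. proj_map A Q = proj_map B Q"
  shows "proj_map A = proj_map B"
proof -
  have "\<exists>c. B *v z = c *s (A *v z)" if z: "Re (herm_form z) > 0" for z
  proof -
    have "z \<noteq> 0" using z by (auto simp: herm_form_def)
    with z have "proj_pt z \<in> gen_ball" by (auto simp: gen_ball_def)
    then show ?thesis
      using assms proj_map_eq_iff[OF assms(1,2) \<open>z \<noteq> 0\<close>] by blast
  qed
  then obtain c where "\<And>x. B *v x = c *s (A *v x)"
    using proportional_on_positive_imp_scalar_multiple[OF assms(1)] by blast
  then show ?thesis
    using proj_map_eq_iff[OF assms(1,2)] by (metis ext proj_pt_cases)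
qed

section \<open>Boundary fixed points of an automorphism without interior fixed points\<close>

theorem corollary3p11:
  fixes f :: "('p :: finite + 'q :: finite) cproj \<Rightarrow> ('p + 'q) cproj"
  assumes "biholomorphic_automorphism gen_ball f"
    and "\<not> (\<exists>l. projective_line l \<and> l \<subseteq> gen_ball_boundary \<and> l \<subseteq> boundary_fixed_points f)"
    and "\<exists>S. S \<subseteq> boundary_fixed_points f \<and> finite S \<and> card S \<ge> 2 * CARD('p) + 1"
  shows "\<exists>P \<in> gen_ball. f P = P"
proof (rule ccontr)
  assume no_fix: "\<not> (\<exists>P \<in> gen_ball. f P = P)"
  obtain S where S: "S \<subseteq> boundary_fixed_points f" "finite S" "card S \<ge> 2 * CARD('p) + 1"
    using assms(3) by blast
  \<comment> \<open>Any point of \<open>S\<close> supplies a matrix in \<open>U_group\<close> that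
    induces \<open>f\<close> on the ball.\<close>
  then have "S \<noteq> {}" by auto
  then obtain A where A: "A \<in> U_group" "\<forall>Q \<in> gen_ball. f Q = proj_map A Q"
    using S(1) by (auto simp: boundary_fixed_points_def)
  have invA: "invertible A" using A(1) by (simp add: U_group_def)
  \<comment> \<open>In \<open>boundary_fixed_points\<close> the matrix may depend on the point; by
    uniqueness of the extension, the single \<open>A\<close> fixes all these points.\<close>
  have fixA: "P \<in> gen_ball_boundary \<and> proj_map A P = P" if P: "P \<in> boundary_fixed_points f" for P
  proof -
    obtain B where B: "B \<in> U_group" "\<forall>Q \<in> gen_ball. f Q = proj_map B Q" "proj_map B P = P"
      using P by (auto simp: boundary_fixed_points_def)
    then have "proj_map A = proj_map B"
      using A(2) invA by (intro proj_map_eq_if_eq_on_gen_ball) (auto simp: U_group_def)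
    with B P show ?thesis by (simp add: boundary_fixed_points_def)
  qed
  \<comment> \<open>A positive eigenvector would represent a fixed point of \<open>f\<close> in the
    ball.\<close>
  have nonpos: "Re (herm_form z) \<le> 0" if "A *v z = e *s z" for e z
  proof (rule ccontr)
    assume pos: "\<not> Re (herm_form z) \<le> 0"
    then have "z \<noteq> 0" by (auto simp: herm_form_def)
    with pos have "proj_pt z \<in> gen_ball" by (force simp: gen_ball_def)
    moreover have "proj_map A (proj_pt z) = proj_pt z"
      using proj_map_fixed_iff[OF invA \<open>z \<noteq> 0\<close>] that by blast
    ultimately show False using A(2) no_fix by auto
  qed
  \<comment> \<open>The chosen representative is a multiple of a null vector, and scaling preserves
    nullity.\<close>
  have null: "herm_form (proj_rep P) = 0" if "P \<in> S" for P
  proof -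
    have "P \<in> gen_ball_boundary" using that S(1) fixA by blast
    then obtain z where z: "z \<noteq> 0" "herm_form z = 0" "P = proj_pt z"
      by (auto simp: gen_ball_boundary_def)
    then obtain c where "proj_rep P = c *s z"
      using proj_pt_eq_iff[of z "proj_rep P"] proj_rep_nonzero[of P] by auto
    with z show ?thesis by (simp add: herm_form_scale)
  qed
  have "\<forall>P\<in>S. \<exists>c. A *v proj_rep P = c *s proj_rep P"
    using S(1) fixA proj_map_fixed_iff[OF invA proj_rep_nonzero] by (metis proj_pt_rep subsetD)
  then obtain e where e: "\<And>P. P \<in> S \<Longrightarrow> A *v proj_rep P = e P *s proj_rep P" by metis
  \<comment> \<open>Two points of \<open>S\<close> with the same eigenvalue would span a projective
    line in the boundary that is fixed pointwise, contrary to the assumption on lines.\<close>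
  have "inj_on e S"
  proof (rule inj_onI, rule ccontr)
    fix P Q assume PQ: "P \<in> S" "Q \<in> S" "e P = e Q" "P \<noteq> Q"
    have "\<nexists>c. proj_rep Q = c *s proj_rep P"
      using PQ(4) proj_pt_eq_iff[of "proj_rep P" "proj_rep Q"] proj_rep_nonzero by auto
    then obtain W where W: "vec.subspace W" "vec.dim W = 2"
      "\<And>z. z \<in> W \<Longrightarrow> A *v z = e P *s z" "\<And>z. z \<in> W \<Longrightarrow> herm_form z = 0"
      using null_eigenvectors_isotropic_line[of "proj_rep P" "proj_rep Q" A "e P"]
        null e PQ proj_rep_nonzero nonpos by metis
    define l where "l = {proj_pt z | z. z \<in> W \<and> z \<noteq> 0}"
    have "projective_line l" unfolding projective_line_def l_def using W by blast
    moreover have bdry: "l \<subseteq> gen_ball_boundary"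
      using W(4) by (auto simp: l_def gen_ball_boundary_def)
    moreover have "l \<subseteq> boundary_fixed_points f"
    proof
      fix R assume R: "R \<in> l"
      then have "proj_map A R = R"
        using W(3) proj_map_fixed_iff[OF invA] by (auto simp: l_def)
      with R bdry A show "R \<in> boundary_fixed_points f"
        by (auto simp: boundary_fixed_points_def)
    qed
    ultimately show False using assms(2) by blast
  qed
  from U_group_null_eigenvalues_card_le[OF A(1) S(2) this, of proj_rep] null e
  have "card S \<le> 2 * CARD('p)" by (simp add: proj_rep_nonzero)
  with S(3) show False by simp
qed

end
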